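(* Let $\theta\in(0,1]$, $a\in(0,1)$ and $b>0$ with $a+b\ge 1$. Let $(Z_n)_{n\ge 0}$ be a (supercritical) Galton-Watson process with one ancestor ($Z_0=1$) and offspring distribution $\mathsf{PF}(\theta,a,b)$, with offspring probability generating function $f$ and offspring mean $\mathsf{m}=f'(1)=a^{-1/\theta}$. Put $W_n=\mathsf{m}^{-n}Z_n$ for $n\ge 0$. Then: (a) The extinction probability $q$ of $(Z_n)_{n\ge 0}$ is $$q=1-\Big(\frac{1-a}{b}\Big)^{1/\theta}.$$ (b) As $n\to\infty$, $W_n$ converges almost surely and in $L^1$ to a random variable $W_\infty$ with Laplace transform $$\varphi(u)=\mathbb{E}e^{-uW_\infty}=1-\Big[\frac{1}{u^{\theta}}+\frac{b}{1-a}\Big]^{-1/\theta},\qquad u\ge 0,$$ and $\varphi$ satisfies the functional equation $\varphi(u)=f\big(\varphi(a^{1/\theta}u)\big)$ for all $u\ge 0$.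
   Context: For $\theta\in(0,1]$ and $a,b>0$ with $a+b\ge 1$, the power-fractional law $\mathsf{PF}(\theta,a,b)$ is the probability distribution on $\mathbb{N}_0$ with probability generating function $f(s)=1-\big[\frac{a}{(1-s)^{\theta}}+b\big]^{-1/\theta}$ for $s\in[0,1)$, $f(1)=1$. Its mean is $a^{-1/\theta}$; the case $a\in(0,1)$ is called supercritical. At $u=0$ the formula for $\varphi$ is understood as the limit value $1$. The extinction probability is $q=\lim_{n\to\infty}\mathbb{P}(Z_n=0)$. *)

theory Defs
  imports "HOL-Probability.Probability"
begin

definition pgf :: "nat pmf \<Rightarrow> real \<Rightarrow> real" where
  "pgf p s = measure_pmf.expectation p (\<lambda>k. s ^ k)"

text \<open>The case split at \<open>s = 1\<close> is needed because \<open>a / 0 = 0\<close> in HOL.\<close>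

definition pf_pgf :: "real \<Rightarrow> real \<Rightarrow> real \<Rightarrow> real \<Rightarrow> real" where
  "pf_pgf \<theta> a b s =
     (if s = 1 then 1 else 1 - (a / (1 - s) powr \<theta> + b) powr (- 1 / \<theta>))"

text \<open>
  \<open>power_fractional \<theta> a b p\<close> says that \<open>p\<close> is the law \<open>PF(\<theta>,a,b)\<close>. A law on the natural
  numbers is determined by its probability generating function on \<open>[0,1]\<close>.
\<close>

definition power_fractional :: "real \<Rightarrow> real \<Rightarrow> real \<Rightarrow> nat pmf \<Rightarrow> bool" where
  "power_fractional \<theta> a b p \<longleftrightarrow> (\<forall>s\<in>{0..1}. pgf p s = pf_pgf \<theta> a b s)"

text \<open>
  One ancestor; \<open>\<xi> n i\<close> is the number of children of individual \<open>i\<close> of generation \<open>n\<close>.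
\<close>

definition galton_watson :: "'a measure \<Rightarrow> nat pmf \<Rightarrow> (nat \<Rightarrow> 'a \<Rightarrow> nat) \<Rightarrow> bool" where
  "galton_watson M p Z \<longleftrightarrow>
     prob_space M \<and>
     (\<exists>\<xi> :: nat \<Rightarrow> nat \<Rightarrow> 'a \<Rightarrow> nat.
        prob_space.indep_vars M (\<lambda>_. count_space UNIV) (\<lambda>(n, i). \<xi> n i) UNIV \<and>
        (\<forall>n i. distr M (count_space UNIV) (\<xi> n i) = measure_pmf p) \<and>
        (\<forall>\<omega>\<in>space M. Z 0 \<omega> = 1) \<and>
        (\<forall>n. \<forall>\<omega>\<in>space M. Z (Suc n) \<omega> = (\<Sum>i<Z n \<omega>. \<xi> n i \<omega>)))"

definition offspring_mean :: "nat pmf \<Rightarrow> real" where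
  "offspring_mean p = measure_pmf.expectation p real"

definition normalized :: "nat pmf \<Rightarrow> (nat \<Rightarrow> 'a \<Rightarrow> nat) \<Rightarrow> nat \<Rightarrow> 'a \<Rightarrow> real" where
  "normalized p Z n \<omega> = real (Z n \<omega>) / offspring_mean p ^ n"

text \<open>At \<open>u = 0\<close> the formula is read as its limit value.\<close>

definition pf_laplace :: "real \<Rightarrow> real \<Rightarrow> real \<Rightarrow> real \<Rightarrow> real" where
  "pf_laplace \<theta> a b u =
     (if u = 0 then 1 else 1 - (1 / u powr \<theta> + b / (1 - a)) powr (- 1 / \<theta>))"

end

theory Submission
  imports Defs
begin

text \<open>
  The functions \<open>t \<mapsto> (a / t powr \<theta> + b) powr (- 1 / \<theta>)\<close> are closed under composition, so that
  \<open>Z n\<close> again has a power-fractional law, with parameters \<open>a ^ n\<close> and \<open>b (1 - a ^ n) / (1 - a)\<close>.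
  The mean, the extinction probability and the limit of the Laplace transforms of \<open>W\<^sub>n\<close> can be read
  off from this.

  Almost sure convergence needs no martingale theory. Since \<open>\<phi>(u) = f(\<phi>(u / m))\<close>, the process
  \<open>X\<^sub>n = \<phi>(m ^ (-n)) ^ Z\<^sub>n\<close> is a bounded martingale, and \<open>f(s\<^sup>2) - f(s)\<^sup>2 = O((1 - s) powr (1 + \<theta>))\<close>
  makes its increments decay geometrically in \<open>L\<^sup>2\<close>, so it converges almost surely. Its limit is
  positive, since \<open>W\<^sub>n\<close> would otherwise tend to infinity, against Fatou and \<open>E W\<^sub>n = 1\<close>; as
  \<open>- ln \<phi>(u) ~ u\<close> at \<open>0\<close>, \<open>W\<^sub>n\<close> converges to \<open>- ln (lim X\<^sub>n)\<close>. The slope of the limiting Laplace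
  transform at \<open>0\<close> shows that the limit has mean \<open>1\<close>, and Scheffe's lemma gives convergence in \<open>L\<^sup>1\<close>.
\<close>

section \<open>The power-fractional generating function\<close>

text \<open>In the coordinate \<open>t = 1 - s\<close>, the offspring generating function and the
  Laplace transform of the limit become members of one family. The value at 0 is set by hand because
  \<open>a / 0 = 0\<close>.\<close>

definition pf_tail :: "real \<Rightarrow> real \<Rightarrow> real \<Rightarrow> real \<Rightarrow> real" where
  "pf_tail \<theta> a b t = (if t = 0 then 0 else (a / t powr \<theta> + b) powr (- 1 / \<theta>))"

lemma pf_pgf_eq: "pf_pgf \<theta> a b s = 1 - pf_tail \<theta> a b (1 - s)"
  by (simp add: pf_pgf_def pf_tail_def)

lemma pf_laplace_eq: "pf_laplace \<theta> a b u = 1 - pf_tail \<theta> 1 (b / (1 - a)) u"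
  by (simp add: pf_laplace_def pf_tail_def)

lemma pf_tail_0 [simp]: "pf_tail \<theta> a b 0 = 0"
  by (simp add: pf_tail_def)

lemma pf_tail_nonneg: "0 \<le> pf_tail \<theta> a b t"
  by (simp add: pf_tail_def)

lemma pf_tail_pos: "0 < a \<Longrightarrow> 0 \<le> b \<Longrightarrow> 0 < t \<Longrightarrow> 0 < pf_tail \<theta> a b t"
  by (smt (verit) divide_pos_pos pf_tail_def powr_gt_zero)

text \<open>In the coordinate \<open>t powr (- \<theta>)\<close> the map
  \<open>pf_tail \<theta> a b\<close> is the affine map \<open>x \<mapsto> a * x + b\<close>, and
  affine maps compose.\<close>

lemma pf_tail_comp:
  assumes "0 < \<theta>" "0 < a" "0 < a'" "0 \<le> b'" "0 \<le> t"
  shows "pf_tail \<theta> a b (pf_tail \<theta> a' b' t) = pf_tail \<theta> (a * a') (a * b' + b) t"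
proof (cases "t = 0")
  case False
  define x where "x = a' / t powr \<theta> + b'"
  have x: "x > 0" using assms False by (simp add: x_def add_pos_nonneg)
  have "(x powr (- 1 / \<theta>)) powr \<theta> = 1 / x"
    using assms x by (simp only: powr_powr) (simp add: powr_minus_divide)
  then have "pf_tail \<theta> a b (pf_tail \<theta> a' b' t) = (a * x + b) powr (- 1 / \<theta>)"
    using x False by (simp add: pf_tail_def flip: x_def)
  also have "a * x + b = a * a' / t powr \<theta> + (a * b' + b)"
    by (simp add: x_def algebra_simps)
  finally show ?thesis using False by (simp add: pf_tail_def)
qed simp

text \<open>Bernoulli's inequality for a negative exponent, from \<open>ln (1 + x) \<le> x\<close>
  and \<open>exp y \<ge> 1 + y\<close>.\<close>

lemma powr_one_plus_ge:
  fixes x c :: real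
  assumes "0 \<le> x" "0 \<le> c"
  shows "1 - c * x \<le> (1 + x) powr (- c)"
proof -
  have "c * ln (1 + x) \<le> c * x"
    using assms ln_add_one_self_le_self[of x] by (intro mult_left_mono) auto
  moreover have "1 + (- c * ln (1 + x)) \<le> exp (- c * ln (1 + x))"
    by (rule exp_ge_add_one_self)
  moreover have "(1 + x) powr (- c) = exp (- c * ln (1 + x))"
    using assms by (simp add: powr_def)
  ultimately show ?thesis by linarith
qed

text \<open>Splits off the linear behaviour at 0: the last factor tends to 1, so the slope is
  \<open>a powr (- 1 / \<theta>)\<close>. Bounding that factor gives the upper and lower estimates
  that follow.\<close>

lemma pf_tail_factor:
  assumes "0 < \<theta>" "0 < a" "0 \<le> b" "0 < t"
  shows "pf_tail \<theta> a b t = a powr (- 1 / \<theta>) * t * (1 + b / a * t powr \<theta>) powr (- 1 / \<theta>)"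
proof -
  have "a / t powr \<theta> + b = a * t powr (- \<theta>) * (1 + b / a * t powr \<theta>)"
    using assms by (simp add: powr_minus field_simps)
  moreover have "(t powr (- \<theta>)) powr (- 1 / \<theta>) = t"
    using assms by (simp add: powr_powr)
  ultimately show ?thesis
    using assms by (simp add: pf_tail_def powr_mult)
qed

lemma pf_tail_le:
  assumes "0 < \<theta>" "0 < a" "0 \<le> b" "0 \<le> t"
  shows "pf_tail \<theta> a b t \<le> a powr (- 1 / \<theta>) * t"
proof (cases "t = 0")
  case False
  have "(1 + b / a * t powr \<theta>) powr (- 1 / \<theta>) \<le> 1 powr (- 1 / \<theta>)"
    using assms by (intro powr_mono2') auto
  then have "a powr (- 1 / \<theta>) * t * (1 + b / a * t powr \<theta>) powr (- 1 / \<theta>) \<le> a powr (- 1 / \<theta>) * t * 1"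
    using assms by (intro mult_left_mono) auto
  then show ?thesis using assms False by (simp add: pf_tail_factor)
qed simp

text \<open>Bernoulli's inequality with exponent \<open>1 / \<theta>\<close> gives a relative error
  of order \<open>t powr \<theta>\<close>, the source of the exponent \<open>1 + \<theta>\<close> in
  the second-moment estimate.\<close>

lemma pf_tail_ge:
  assumes "0 < \<theta>" "0 < a" "0 \<le> b" "0 \<le> t"
  shows "a powr (- 1 / \<theta>) * t * (1 - b / (a * \<theta>) * t powr \<theta>) \<le> pf_tail \<theta> a b t"
proof (cases "t = 0")
  case False
  have "1 - b / (a * \<theta>) * t powr \<theta> \<le> (1 + b / a * t powr \<theta>) powr (- 1 / \<theta>)"
    using powr_one_plus_ge[of "b / a * t powr \<theta>" "1 / \<theta>"] assms by (simp add: field_simps)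
  then have "a powr (- 1 / \<theta>) * t * (1 - b / (a * \<theta>) * t powr \<theta>)
      \<le> a powr (- 1 / \<theta>) * t * (1 + b / a * t powr \<theta>) powr (- 1 / \<theta>)"
    using assms by (intro mult_left_mono) auto
  then show ?thesis using assms False by (simp add: pf_tail_factor)
qed simp

lemma pf_tail_less_1:
  assumes "0 < \<theta>" "0 < a" "1 \<le> b" "0 \<le> t"
  shows "pf_tail \<theta> a b t < 1"
proof (cases "t = 0")
  case False
  then have "1 < a / t powr \<theta> + b" using assms by (smt (verit) divide_pos_pos powr_gt_zero)
  then show ?thesis using assms False by (simp add: pf_tail_def powr_less_one)
qed simp

text \<open>This slope yields the offspring mean, the mean of \<open>Z n\<close>, the asymptotics of
  \<open>- ln (s n)\<close> and the mean of the limit.\<close>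

lemma pf_tail_div_tendsto:
  assumes "0 < \<theta>" "0 < a" "0 \<le> b"
  shows "((\<lambda>t. pf_tail \<theta> a b t / t) \<longlongrightarrow> a powr (- 1 / \<theta>)) (at_right 0)"
proof (rule tendsto_sandwich)
  show "\<forall>\<^sub>F t in at_right 0. a powr (- 1 / \<theta>) * (1 - b / (a * \<theta>) * t powr \<theta>) \<le> pf_tail \<theta> a b t / t"
    using pf_tail_ge[OF assms] by (auto simp: eventually_at_filter field_simps)
  show "\<forall>\<^sub>F t in at_right 0. pf_tail \<theta> a b t / t \<le> a powr (- 1 / \<theta>)"
    using pf_tail_le[OF assms] by (auto simp: eventually_at_filter field_simps)
  have "((\<lambda>t. t powr \<theta>) \<longlongrightarrow> 0) (at_right 0)"
    using assms by (intro tendsto_eq_intros refl) (auto simp: eventually_at_filter)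
  then have "((\<lambda>t. a powr (- 1 / \<theta>) * (1 - b / (a * \<theta>) * t powr \<theta>)) \<longlongrightarrow>
      a powr (- 1 / \<theta>) * (1 - b / (a * \<theta>) * 0)) (at_right 0)"
    by (intro tendsto_intros)
  then show "((\<lambda>t. a powr (- 1 / \<theta>) * (1 - b / (a * \<theta>) * t powr \<theta>)) \<longlongrightarrow> a powr (- 1 / \<theta>)) (at_right 0)"
    by simp
qed simp

section \<open>The limiting Laplace transform and its functional equation\<close>

lemma pf_laplace_bounds:
  assumes "0 < \<theta>" "0 < a" "a < 1" "a + b \<ge> 1" "0 \<le> u"
  shows "0 < pf_laplace \<theta> a b u" "pf_laplace \<theta> a b u \<le> 1"
  \<comment> \<open>The hypothesis \<open>1 \<le> b / (1 - a)\<close> of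
    \<open>pf_tail_less_1\<close> amounts to \<open>a + b \<ge> 1\<close>.\<close>
  using assms pf_tail_less_1[of \<theta> 1 "b / (1 - a)" u] pf_tail_nonneg[of \<theta> 1 "b / (1 - a)" u]
  by (auto simp: pf_laplace_eq)

lemma pf_laplace_less_1:
  assumes "a < 1" "0 < b" "0 < u"
  shows "pf_laplace \<theta> a b u < 1"
  using assms pf_tail_pos[of 1 "b / (1 - a)" u \<theta>] by (simp add: pf_laplace_eq)

text \<open>\<open>b / (1 - a)\<close> is the fixed point of \<open>x \<mapsto> a * x + b\<close>,
  so composition with the offspring function changes only the first parameter, from 1 to
  \<open>a\<close>; the factor \<open>a powr (1 / \<theta>)\<close> in the argument undoes
  that.\<close>

lemma pf_pgf_pf_laplace:
  assumes "0 < \<theta>" "0 < a" "a < 1" "0 < b" "0 \<le> u"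
  shows "pf_pgf \<theta> a b (pf_laplace \<theta> a b (a powr (1 / \<theta>) * u)) = pf_laplace \<theta> a b u"
proof -
  have "a * (b / (1 - a)) + b = b / (1 - a)" using assms by (simp add: field_simps)
  then have "pf_pgf \<theta> a b (pf_laplace \<theta> a b (a powr (1 / \<theta>) * u))
      = 1 - pf_tail \<theta> a (b / (1 - a)) (a powr (1 / \<theta>) * u)"
    using assms pf_tail_comp[of \<theta> a 1 "b / (1 - a)" "a powr (1 / \<theta>) * u" b]
    by (simp add: pf_laplace_eq pf_pgf_eq)
  also have "pf_tail \<theta> a (b / (1 - a)) (a powr (1 / \<theta>) * u) = pf_tail \<theta> 1 (b / (1 - a)) u"
    using assms by (simp add: pf_tail_def powr_mult powr_powr)
  finally show ?thesis by (simp add: pf_laplace_eq)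
qed

text \<open>With \<open>t = 1 - s\<close> and \<open>m\<close> the slope, both terms are
  \<open>1 - 2 * m * t\<close> to first order, and these parts cancel. The first term is bounded
  above through \<open>pf_tail_ge\<close>, the second below through \<open>pf_tail_le\<close> and
  \<open>x ^ 2 \<ge> 2 * x - 1\<close>.\<close>

lemma pf_pgf_square_diff_le:
  assumes "0 < \<theta>" "\<theta> \<le> 1" "0 < a" "0 \<le> b"
  obtains C where "0 \<le> C" and
    "\<And>s. \<lbrakk>0 \<le> s; s \<le> 1\<rbrakk> \<Longrightarrow> pf_pgf \<theta> a b (s\<^sup>2) - (pf_pgf \<theta> a b s)\<^sup>2 \<le> C * (1 - s) powr (1 + \<theta>)"
proof
  define m where "m = a powr (- 1 / \<theta>)"
  \<comment> \<open>The 1 accounts for \<open>t ^ 2 \<le> t powr (1 + \<theta>)\<close>, which uses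
    \<open>\<theta> \<le> 1\<close>; the 4 bounds \<open>2 powr (1 + \<theta>)\<close>.\<close>
  define C where "C = m * (1 + b / (a * \<theta>) * 4)"
  have m: "0 \<le> m" by (simp add: m_def)
  show "0 \<le> C" using assms m by (simp add: C_def)
  fix s :: real assume s: "0 \<le> s" "s \<le> 1"
  define t where "t = 1 - s"
  have t: "0 \<le> t" "t \<le> 1" using s by (auto simp: t_def)
  have t2: "1 - s\<^sup>2 = 2 * t - t\<^sup>2" by (simp add: t_def power2_eq_square algebra_simps)
  have t2_nn: "0 \<le> 2 * t - t\<^sup>2" unfolding t2[symmetric] using s by (simp add: power_le_one)
  have "(2 * t - t\<^sup>2) * (2 * t - t\<^sup>2) powr \<theta> \<le> (2 * t) * (2 * t) powr \<theta>"
    using assms t t2_nn by (intro mult_mono powr_mono2) auto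
  also have "\<dots> = 2 powr (1 + \<theta>) * t powr (1 + \<theta>)"
    using t assms by (cases "t = 0") (simp_all add: powr_add powr_mult)
  also have "\<dots> \<le> 2 powr 2 * t powr (1 + \<theta>)"
    using assms by (intro mult_right_mono powr_mono) auto
  finally have 2: "(2 * t - t\<^sup>2) * (2 * t - t\<^sup>2) powr \<theta> \<le> 4 * t powr (1 + \<theta>)"
    by simp
  have 3: "t\<^sup>2 \<le> t powr (1 + \<theta>)"
  proof (cases "t = 0")
    case False
    then have "t\<^sup>2 = t powr 2" using t by simp
    also have "\<dots> \<le> t powr (1 + \<theta>)" using t False assms by (intro powr_mono') auto
    finally show ?thesis .
  qed simp
  define d where "d = b / (a * \<theta>)"
  have d: "0 \<le> d" using assms by (simp add: d_def)
  have "pf_pgf \<theta> a b (s\<^sup>2) \<le> 1 - m * (2 * t - t\<^sup>2) * (1 - d * (2 * t - t\<^sup>2) powr \<theta>)"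
    using pf_tail_ge[of \<theta> a b "1 - s\<^sup>2"] assms t2_nn by (simp add: pf_pgf_eq t2 m_def d_def)
  also have "\<dots> = 1 - 2 * m * t + m * t\<^sup>2 + m * d * ((2 * t - t\<^sup>2) * (2 * t - t\<^sup>2) powr \<theta>)"
    by (simp add: algebra_simps)
  also have "\<dots> \<le> 1 - 2 * m * t + m * t powr (1 + \<theta>) + m * d * (4 * t powr (1 + \<theta>))"
    using m d by (intro add_mono mult_left_mono 2 3) auto
  also have "\<dots> = 1 - 2 * m * t + C * t powr (1 + \<theta>)"
    by (simp add: C_def d_def algebra_simps)
  finally have 1: "pf_pgf \<theta> a b (s\<^sup>2) \<le> 1 - 2 * m * t + C * t powr (1 + \<theta>)" .
  have "1 - m * t \<le> pf_pgf \<theta> a b s"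
    using pf_tail_le[of \<theta> a b t] assms t by (simp add: pf_pgf_eq t_def m_def)
  moreover have "2 * pf_pgf \<theta> a b s - 1 \<le> (pf_pgf \<theta> a b s)\<^sup>2"
    using zero_le_power2[of "pf_pgf \<theta> a b s - 1"] by (simp add: power2_eq_square algebra_simps)
  ultimately show "pf_pgf \<theta> a b (s\<^sup>2) - (pf_pgf \<theta> a b s)\<^sup>2 \<le> C * (1 - s) powr (1 + \<theta>)"
    using 1 by (simp add: t_def algebra_simps)
qed

section \<open>Galton-Watson processes\<close>

text \<open>No integrability is presupposed: the difference quotient at 1 is the expectation of a
  geometric sum that increases to \<open>X\<close> as \<open>t\<close> decreases to 0, so monotone
  convergence applies.\<close>

lemma (in prob_space) expectation_eq_of_gf:
  fixes X :: "'a \<Rightarrow> nat"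
  assumes X [measurable]: "X \<in> measurable M (count_space UNIV)"
    and lim: "((\<lambda>t. (1 - expectation (\<lambda>\<omega>. (1 - t) ^ X \<omega>)) / t) \<longlongrightarrow> L) (at_right 0)"
  shows "integrable M (\<lambda>\<omega>. real (X \<omega>))" "expectation (\<lambda>\<omega>. real (X \<omega>)) = L"
proof -
  define t where "t j = inverse (real (Suc j))" for j
  have t: "0 < t j" "t j \<le> 1" for j by (simp_all add: t_def divide_simps)
  have t0: "t \<longlonglongrightarrow> 0"
    unfolding t_def by (rule LIMSEQ_inverse_real_of_nat)
  define F where "F j \<omega> = (1 - (1 - t j) ^ X \<omega>) / t j" for j \<omega>
  have F_eq: "F j \<omega> = (\<Sum>i<X \<omega>. (1 - t j) ^ i)" for j \<omega>
    using t[of j] by (simp add: F_def sum_gp_strict)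
  have int_pow: "integrable M (\<lambda>\<omega>. (1 - t j) ^ X \<omega>)" for j
    using t[of j] by (intro integrable_const_bound[where B = 1]) (auto simp: power_le_one)
  have int: "integrable M (F j)" for j
    unfolding F_def using int_pow[of j] by auto
  have mono: "mono (\<lambda>j. F j \<omega>)" for \<omega>
    unfolding F_eq
  proof (intro monoI sum_mono power_mono)
    fix i j :: nat assume "i \<le> j"
    then show "1 - t i \<le> 1 - t j" by (simp add: t_def le_imp_inverse_le)
  qed (use t in auto)
  have lim_F: "(\<lambda>j. F j \<omega>) \<longlonglongrightarrow> real (X \<omega>)" for \<omega>
  proof -
    have "(\<lambda>j. \<Sum>i<X \<omega>. (1 - t j) ^ i) \<longlonglongrightarrow> (\<Sum>i<X \<omega>. (1 - 0) ^ i)"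
      by (intro tendsto_intros t0)
    then show ?thesis by (simp add: F_eq)
  qed
  have "filterlim t (at_right 0) sequentially"
    using t0 t by (auto simp: filterlim_at less_imp_neq[symmetric])
  then have "(\<lambda>j. (1 - expectation (\<lambda>\<omega>. (1 - t j) ^ X \<omega>)) / t j) \<longlonglongrightarrow> L"
    using lim by (rule filterlim_compose[rotated])
  moreover have "expectation (F j) = (1 - expectation (\<lambda>\<omega>. (1 - t j) ^ X \<omega>)) / t j" for j
    unfolding F_def using int_pow[of j] by (simp add: prob_space)
  ultimately have ilim: "(\<lambda>j. expectation (F j)) \<longlonglongrightarrow> L" by simp
  have nonneg: "0 \<le> F j \<omega>" for j \<omega>
    unfolding F_eq using t[of j] by (intro sum_nonneg) auto
  note * = integral_monotone_convergence_nonneg[of M F "\<lambda>\<omega>. real (X \<omega>)" L, OF int _ _ _ ilim]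
  show "integrable M (\<lambda>\<omega>. real (X \<omega>))" "expectation (\<lambda>\<omega>. real (X \<omega>)) = L"
    by (intro * AE_I2 mono nonneg lim_F; measurable)+
qed

text \<open>Stands in for conditioning on \<open>X\<close>: truncations to \<open>X < n\<close> are
  finite sums over fibres and converge by dominated convergence.\<close>

lemma (in prob_space) expectation_eq_on_fibres:
  fixes X :: "'a \<Rightarrow> nat" and F G :: "'a \<Rightarrow> real"
  assumes X [measurable]: "X \<in> measurable M (count_space UNIV)"
    and F: "integrable M F" and G: "integrable M G"
    and eq: "\<And>k. expectation (\<lambda>\<omega>. indicator {k} (X \<omega>) * F \<omega>) = expectation (\<lambda>\<omega>. indicator {k} (X \<omega>) * G \<omega>)"
  shows "expectation F = expectation G"
proof -
  have int: "integrable M (\<lambda>\<omega>. indicator A (X \<omega>) * H \<omega>)" if "integrable M H" for H :: "'a \<Rightarrow> real" and A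
    by (rule Bochner_Integration.integrable_bound[OF that])
      (use that in \<open>auto simp: indicator_def abs_mult\<close>)
  have lim: "(\<lambda>n. \<Sum>k<n. expectation (\<lambda>\<omega>. indicator {k} (X \<omega>) * H \<omega>)) \<longlonglongrightarrow> expectation H"
    if H: "integrable M H" for H :: "'a \<Rightarrow> real"
  proof -
    have "(\<lambda>n. expectation (\<lambda>\<omega>. indicator {..<n} (X \<omega>) * H \<omega>)) \<longlonglongrightarrow> expectation H"
    proof (rule integral_dominated_convergence[where w = "\<lambda>\<omega>. \<bar>H \<omega>\<bar>"])
      show "AE \<omega> in M. (\<lambda>n. indicator {..<n} (X \<omega>) * H \<omega>) \<longlonglongrightarrow> H \<omega>"
      proof (intro AE_I2 tendsto_eventually)
        fix \<omega>
        show "\<forall>\<^sub>F n in sequentially. indicator {..<n} (X \<omega>) * H \<omega> = H \<omega>"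
          using eventually_gt_at_top[of "X \<omega>"] by eventually_elim simp
      qed
    qed (use H in \<open>auto simp: indicator_def abs_mult\<close>)
    moreover have "expectation (\<lambda>\<omega>. indicator {..<n} (X \<omega>) * H \<omega>)
        = (\<Sum>k<n. expectation (\<lambda>\<omega>. indicator {k} (X \<omega>) * H \<omega>))" for n
    proof -
      have "(\<lambda>\<omega>. indicator {..<n} (X \<omega>) * H \<omega>) = (\<lambda>\<omega>. \<Sum>k<n. indicator {k} (X \<omega>) * H \<omega>)"
        by (auto simp: fun_eq_iff indicator_def sum.If_cases simp flip: sum_distrib_right)
      then show ?thesis
        by (simp only:) (rule Bochner_Integration.integral_sum, rule int[OF H])
    qed
    ultimately show ?thesis by simp
  qed
  show ?thesis
    using LIMSEQ_unique[OF lim[OF F]] lim[OF G] eq by simp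
qed

text \<open>Tonelli: the sum has finite expectation, hence is finite almost surely.\<close>

lemma (in prob_space) AE_summable_of_summable_expectation:
  fixes f :: "nat \<Rightarrow> 'a \<Rightarrow> real"
  assumes int: "\<And>n. integrable M (f n)" and nonneg: "\<And>n \<omega>. 0 \<le> f n \<omega>"
    and sum: "summable (\<lambda>n. expectation (f n))"
  shows "AE \<omega> in M. summable (\<lambda>n. f n \<omega>)"
proof -
  have [measurable]: "f n \<in> borel_measurable M" for n using int by auto
  have "(\<integral>\<^sup>+\<omega>. (\<Sum>n. ennreal (f n \<omega>)) \<partial>M) = (\<Sum>n. \<integral>\<^sup>+\<omega>. ennreal (f n \<omega>) \<partial>M)"
    by (rule nn_integral_suminf) auto
  also have "\<dots> = (\<Sum>n. ennreal (expectation (f n)))"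
    using int nonneg by (simp add: nn_integral_eq_integral)
  also have "\<dots> \<noteq> top"
    using sum nonneg by (intro ennreal_suminf_neq_top) auto
  finally have "AE \<omega> in M. (\<Sum>n. ennreal (f n \<omega>)) \<noteq> \<infinity>"
    by (intro nn_integral_PInf_AE) auto
  then show ?thesis
    by eventually_elim (use nonneg in \<open>auto intro!: summable_suminf_not_top\<close>)
qed

text \<open>The variance of \<open>\<bar>f\<bar>\<close> is nonnegative.\<close>

lemma (in prob_space) expectation_abs_le_sqrt:
  fixes f :: "'a \<Rightarrow> real"
  assumes "integrable M f" "integrable M (\<lambda>\<omega>. (f \<omega>)\<^sup>2)"
  shows "expectation (\<lambda>\<omega>. \<bar>f \<omega>\<bar>) \<le> sqrt (expectation (\<lambda>\<omega>. (f \<omega>)\<^sup>2))"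
  using variance_positive[of "\<lambda>\<omega>. \<bar>f \<omega>\<bar>"] assms
  by (intro real_le_rsqrt) (simp add: variance_eq)

text \<open>Only an upper bound on \<open>x - y\<close> will be at hand, so the estimate is
  one-sided. Being linear in \<open>k\<close>, it can be integrated at \<open>k = Z n\<close>
  knowing only the mean.\<close>

lemma diff_power_le:
  fixes x y d :: real
  assumes "0 \<le> x" "x \<le> 1" "0 \<le> y" "y \<le> 1" "x - y \<le> d" "0 \<le> d"
  shows "x ^ k - y ^ k \<le> real k * d"
proof (cases "x \<le> y")
  case True
  then have "x ^ k - y ^ k \<le> 0" using assms by (simp add: power_mono)
  then show ?thesis using assms by (smt (verit) mult_nonneg_nonneg of_nat_0_le_iff)
next
  case False
  have "\<bar>x ^ k - y ^ k\<bar> \<le> real k * \<bar>x - y\<bar>"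
    using norm_power_diff[of x y k] assms by simp
  also have "\<dots> \<le> real k * d"
    using False assms by (intro mult_left_mono) auto
  finally show ?thesis by linarith
qed

lemma measurable_sum_nat:
  fixes f :: "'i \<Rightarrow> 'a \<Rightarrow> nat"
  assumes "\<And>i. i \<in> I \<Longrightarrow> f i \<in> measurable M (count_space UNIV)"
  shows "(\<lambda>x. \<Sum>i\<in>I. f i x) \<in> measurable M (count_space UNIV)"
  using assms
proof (induction I rule: infinite_finite_induct)
  case (insert i I)
  have "(\<lambda>x. f i x + (\<Sum>j\<in>I. f j x)) \<in> measurable M (count_space UNIV)"
  proof (rule measurable_compose_countable[where f = "\<lambda>k x. k + (\<Sum>j\<in>I. f j x)"])
    show "(\<lambda>x. k + (\<Sum>j\<in>I. f j x)) \<in> measurable M (count_space UNIV)" for k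
      by (rule measurable_compose[where g = "\<lambda>j. k + j" and N = "count_space UNIV"])
        (use insert in auto)
  qed (use insert in auto)
  then show ?case using insert by simp
qed auto

section \<open>The process and its branching property\<close>

locale galton_watson_process = prob_space M for M :: "'a measure" +
  fixes p :: "nat pmf" and Z :: "nat \<Rightarrow> 'a \<Rightarrow> nat" and \<xi> :: "nat \<Rightarrow> nat \<Rightarrow> 'a \<Rightarrow> nat"
  assumes indep: "indep_vars (\<lambda>_. count_space UNIV) (\<lambda>(n, i). \<xi> n i) UNIV"
    and distr_offspring: "\<And>n i. distr M (count_space UNIV) (\<xi> n i) = measure_pmf p"
    and Z_0: "\<And>\<omega>. \<omega> \<in> space M \<Longrightarrow> Z 0 \<omega> = 1"
    and Z_Suc: "\<And>n \<omega>. \<omega> \<in> space M \<Longrightarrow> Z (Suc n) \<omega> = (\<Sum>i<Z n \<omega>. \<xi> n i \<omega>)"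
begin

lemma measurable_offspring [measurable]: "\<xi> n i \<in> measurable M (count_space UNIV)"
  using indep by (auto simp: indep_vars_def dest: spec[of _ n])

text \<open>Realises \<open>Z n\<close> as a function of the offspring numbers of the generations before \<open>n\<close>,
  which makes it independent of those of generation \<open>n\<close>.\<close>

fun population :: "nat \<Rightarrow> (nat \<times> nat \<Rightarrow> nat) \<Rightarrow> nat" where
  "population 0 x = 1"
| "population (Suc n) x = (\<Sum>i<population n x. x (n, i))"

lemma measurable_population:
  assumes "{..<n} \<times> UNIV \<subseteq> A"
  shows "population n \<in> measurable (Pi\<^sub>M A (\<lambda>_. count_space UNIV)) (count_space UNIV)"
  using assms
proof (induction n)
  case (Suc n)
  show ?case
    unfolding population.simps
  \<comment> \<open>The number of summands is random; fixing each of its countably many values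
    leaves a finite sum.\<close>
  proof (rule measurable_compose_countable[where f = "\<lambda>k x. \<Sum>i<k. x (n, i)"])
    show "(\<lambda>x. \<Sum>i<k. x (n, i)) \<in> measurable (Pi\<^sub>M A (\<lambda>_. count_space (UNIV :: nat set))) (count_space UNIV)" for k
      using Suc.prems by (intro measurable_sum_nat measurable_component_singleton) auto
    show "population n \<in> measurable (Pi\<^sub>M A (\<lambda>_. count_space UNIV)) (count_space UNIV)"
      using Suc.prems by (intro Suc.IH) auto
  qed
next
  case 0
  have "population 0 = (\<lambda>_. 1)" by (simp add: fun_eq_iff)
  then show ?case by simp
qed

text \<open>The index set is kept general: all indices give measurability of \<open>Z n\<close>,
  those of generations before \<open>n\<close> give independence.\<close>

lemma Z_eq_population:
  assumes "\<omega> \<in> space M" "{..<n} \<times> UNIV \<subseteq> A"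
  shows "Z n \<omega> = population n (restrict (\<lambda>j. (case j of (n, i) \<Rightarrow> \<xi> n i) \<omega>) A)"
  using assms(2)
proof (induction n)
  case (Suc n)
  then have "{..<n} \<times> UNIV \<subseteq> A" and "(n, i) \<in> A" for i by auto
  with Suc.IH show ?case by (simp add: Z_Suc assms(1))
qed (simp add: Z_0 assms(1))

lemma measurable_Z [measurable]: "Z n \<in> measurable M (count_space UNIV)"
proof -
  have "(\<lambda>\<omega>. population n (restrict (\<lambda>j. (case j of (n, i) \<Rightarrow> \<xi> n i) \<omega>) UNIV)) \<in> measurable M (count_space UNIV)"
    by (rule measurable_compose[OF _ measurable_population[of n UNIV]])
      (auto intro!: measurable_restrict split: prod.split)
  then show ?thesis
    by (subst measurable_cong[OF Z_eq_population[of _ n UNIV]]) auto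
qed

lemma expectation_pow_offspring: "expectation (\<lambda>\<omega>. s ^ \<xi> n i \<omega>) = pgf p s"
  unfolding pgf_def distr_offspring[of n i, symmetric]
  by (subst integral_distr) auto

lemma integrable_pow:
  fixes r s :: real
  assumes "0 \<le> r" "r \<le> 1" "0 \<le> s" "s \<le> 1"
    and [measurable]: "X \<in> measurable M (count_space UNIV)" "Y \<in> measurable M (count_space UNIV)"
  shows "integrable M (\<lambda>\<omega>. r ^ X \<omega> * s ^ Y \<omega>)"
  using assms by (intro integrable_const_bound[where B = 1]) (auto simp: power_le_one mult_le_one)

text \<open>On \<open>Z n = k\<close> the next generation is a sum of \<open>k\<close> fixed
  offspring numbers, independent of each other and of the past, each contributing a factor
  \<open>pgf p s\<close>.\<close>

lemma expectation_fibre: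
  assumes s: "0 \<le> s" "s \<le> 1"
  shows "expectation (\<lambda>\<omega>. indicator {k} (Z n \<omega>) * (r ^ Z n \<omega> * s ^ Z (Suc n) \<omega>)) =
    expectation (\<lambda>\<omega>. indicator {k} (Z n \<omega>) * (r * pgf p s) ^ Z n \<omega>)"
proof -
  define A where "A = {..<n} \<times> (UNIV :: nat set)"
  define B where "B = {n} \<times> {..<k}"
  \<comment> \<open>On the fibre \<open>r ^ k\<close> equals \<open>r ^ Z n\<close>; as a constant
    it keeps \<open>Y1\<close> bounded for every real \<open>r\<close>.\<close>
  define Y1 where "Y1 x = indicator {k} (population n x) * r ^ k" for x
  define Y2 where "Y2 x = (\<Prod>j\<in>B. s ^ x j)" for x :: "nat \<times> nat \<Rightarrow> nat"
  define past where "past \<omega> = restrict (\<lambda>j. (case j of (n, i) \<Rightarrow> \<xi> n i) \<omega>) A" for \<omega>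
  define present where "present \<omega> = restrict (\<lambda>j. (case j of (n, i) \<Rightarrow> \<xi> n i) \<omega>) B" for \<omega>
  have past: "population n (past \<omega>) = Z n \<omega>" if "\<omega> \<in> space M" for \<omega>
    unfolding past_def using that by (intro Z_eq_population[symmetric]) (auto simp: A_def)
  have present: "Y2 (present \<omega>) = (\<Prod>j\<in>B. s ^ (case j of (n, i) \<Rightarrow> \<xi> n i) \<omega>)" for \<omega>
    unfolding Y2_def present_def by (intro prod.cong) auto
  have present_sum: "Y2 (present \<omega>) = s ^ (\<Sum>i<k. \<xi> n i \<omega>)" for \<omega>
    unfolding present B_def power_sum by (rule prod.reindex_bij_witness[of _ "\<lambda>i. (n, i)" snd]) auto
  \<comment> \<open>\<open>past\<close> and \<open>present\<close> read disjoint sets of offspring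
    variables.\<close>
  have "indep_var (Pi\<^sub>M A (\<lambda>_. count_space UNIV)) past (Pi\<^sub>M B (\<lambda>_. count_space UNIV)) present"
    unfolding past_def present_def by (rule indep_var_restrict[OF indep]) (auto simp: A_def B_def)
  then have ind: "indep_var borel (Y1 \<circ> past) borel (Y2 \<circ> present)"
  proof (rule indep_var_compose)
    show "Y1 \<in> borel_measurable (Pi\<^sub>M A (\<lambda>_. count_space UNIV))"
      unfolding Y1_def by (rule measurable_compose[OF measurable_population]) (auto simp: A_def)
    show "Y2 \<in> borel_measurable (Pi\<^sub>M B (\<lambda>_. count_space UNIV))"
      unfolding Y2_def
      by (intro borel_measurable_prod measurable_compose[OF measurable_component_singleton]) auto
  qed
  have int1: "integrable M (Y1 \<circ> past)"
    using indep_var_rv1[OF ind]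
    by (rule integrable_const_bound[where B = "\<bar>r ^ k\<bar>", rotated])
      (auto simp: Y1_def indicator_def)
  have int2: "integrable M (Y2 \<circ> present)"
    using indep_var_rv2[OF ind] s
    by (intro integrable_const_bound[where B = 1]) (auto simp: present_sum power_le_one)
  have "expectation (Y2 \<circ> present) = (\<Prod>j\<in>B. expectation (\<lambda>\<omega>. s ^ (case j of (n, i) \<Rightarrow> \<xi> n i) \<omega>))"
    unfolding comp_def present
  proof (rule indep_vars_lebesgue_integral)
    have "indep_vars (\<lambda>_. count_space UNIV) (\<lambda>(n, i). \<xi> n i) B"
      using indep by (rule indep_vars_subset) simp
    from indep_vars_compose[OF this, of "\<lambda>_ x. s ^ x" "\<lambda>_. borel"]
    show "indep_vars (\<lambda>_. borel) (\<lambda>j \<omega>. s ^ (case j of (n, i) \<Rightarrow> \<xi> n i) \<omega>) B"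
      by (simp add: comp_def)
    show "integrable M (\<lambda>\<omega>. s ^ (case j of (n, i) \<Rightarrow> \<xi> n i) \<omega>)" for j
      using s by (cases j) (auto intro!: integrable_const_bound[where B = 1] simp: power_le_one)
  qed (simp add: B_def)
  also have "\<dots> = (\<Prod>j\<in>B. pgf p s)"
    by (intro prod.cong) (auto simp: expectation_pow_offspring)
  finally have exp2: "expectation (Y2 \<circ> present) = pgf p s ^ k"
    by (simp add: B_def)
  have "expectation (\<lambda>\<omega>. indicator {k} (Z n \<omega>) * (r ^ Z n \<omega> * s ^ Z (Suc n) \<omega>)) =
      expectation (\<lambda>\<omega>. (Y1 \<circ> past) \<omega> * (Y2 \<circ> present) \<omega>)"
    by (intro Bochner_Integration.integral_cong)
      (auto simp: Y1_def past present_sum Z_Suc indicator_def)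
  also have "\<dots> = expectation (Y1 \<circ> past) * pgf p s ^ k"
    unfolding exp2[symmetric] by (rule indep_var_lebesgue_integral[OF ind int1 int2])
  also have "\<dots> = expectation (\<lambda>\<omega>. (Y1 \<circ> past) \<omega> * pgf p s ^ k)"
    by (simp add: comp_def)
  also have "\<dots> = expectation (\<lambda>\<omega>. indicator {k} (Z n \<omega>) * (r * pgf p s) ^ Z n \<omega>)"
    by (intro Bochner_Integration.integral_cong)
      (auto simp: Y1_def past indicator_def power_mult_distrib)
  finally show ?thesis .
qed

lemma pgf_bounds:
  assumes "0 \<le> s" "s \<le> 1"
  shows "0 \<le> pgf p s" "pgf p s \<le> 1"
proof -
  show "0 \<le> pgf p s" using assms by (simp add: pgf_def)
  show "pgf p s \<le> 1" unfolding pgf_def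
    using assms by (intro measure_pmf.integral_le_const measure_pmf.integrable_const_bound[where B = 1])
      (auto simp: power_le_one)
qed

text \<open>The tower rule for one generation. \<open>r = 1\<close> iterates the generating
  function; a general weight \<open>r\<close> is needed for the cross term of the martingale
  increments.\<close>

lemma branching:
  assumes "0 \<le> r" "r \<le> 1" "0 \<le> s" "s \<le> 1"
  shows "expectation (\<lambda>\<omega>. r ^ Z n \<omega> * s ^ Z (Suc n) \<omega>) = expectation (\<lambda>\<omega>. (r * pgf p s) ^ Z n \<omega>)"
proof (rule expectation_eq_on_fibres[OF measurable_Z[of n]])
  show "integrable M (\<lambda>\<omega>. r ^ Z n \<omega> * s ^ Z (Suc n) \<omega>)"
    using assms by (intro integrable_pow) auto
  show "integrable M (\<lambda>\<omega>. (r * pgf p s) ^ Z n \<omega>)"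
    using integrable_pow[of r "pgf p s" "Z n" "Z n"] assms pgf_bounds[of s]
    by (simp add: power_mult_distrib)
qed (rule expectation_fibre[OF assms(3,4)])

end

lemma galton_watsonE:
  assumes "galton_watson M p Z"
  obtains \<xi> where "galton_watson_process M p Z \<xi>"
  using assms unfolding galton_watson_def galton_watson_process_def galton_watson_process_axioms_def
  by blast

section \<open>Power-fractional offspring\<close>

locale power_fractional_process = galton_watson_process M p Z \<xi>
  for M :: "'a measure" and p Z \<xi> +
  fixes \<theta> a b :: real
  assumes \<theta>: "0 < \<theta>" "\<theta> \<le> 1" and a: "0 < a" "a < 1" and b: "0 < b" "a + b \<ge> 1"
    and pf: "power_fractional \<theta> a b p"
begin

text \<open>The inverse \<open>\<rho>\<close> of the offspring mean; \<open>Z n\<close> has law \<open>PF(\<theta>, a ^ n, b_iter n)\<close>.\<close>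

definition \<rho> :: real where "\<rho> = a powr (1 / \<theta>)"

definition b_iter :: "nat \<Rightarrow> real" where "b_iter n = b * (1 - a ^ n) / (1 - a)"

lemma \<rho>: "0 < \<rho>" "\<rho> < 1"
  using a \<theta> powr_less_mono2[of "1 / \<theta>" a 1] by (auto simp: \<rho>_def)

lemma \<rho>_pow_pos [simp]: "0 < \<rho> ^ n"
  using \<rho> by simp

lemma \<rho>_pow_tendsto: "(\<lambda>n. \<rho> ^ n) \<longlonglongrightarrow> 0"
  using \<rho> by (intro LIMSEQ_realpow_zero) auto

lemma \<rho>_pow_at_right: "filterlim (\<lambda>n. \<rho> ^ n) (at_right 0) sequentially"
  using \<rho>_pow_tendsto \<rho> by (auto simp: filterlim_at)

lemma \<rho>_pow_powr: "(\<rho> ^ n) powr \<theta> = a ^ n"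
proof -
  have "(\<rho> ^ n) powr \<theta> = (\<rho> powr \<theta>) ^ n"
    using \<rho> by (simp add: powr_power powr_powr mult.commute flip: powr_realpow)
  also have "\<rho> powr \<theta> = a" using a \<theta> by (simp add: \<rho>_def powr_powr)
  finally show ?thesis .
qed

lemma a_pow_powr: "(a ^ n) powr (- 1 / \<theta>) = (1 / \<rho>) ^ n"
proof -
  have "(a ^ n) powr (- 1 / \<theta>) = ((\<rho> ^ n) powr \<theta>) powr (- 1 / \<theta>)"
    by (simp add: \<rho>_pow_powr)
  also have "\<dots> = (\<rho> ^ n) powr (- 1)"
    using \<theta> by (simp only: powr_powr) simp
  also have "\<dots> = (1 / \<rho>) ^ n"
    using \<rho> by (simp add: powr_minus_divide power_one_over)
  finally show ?thesis .
qed

lemma b_iter_nonneg: "0 \<le> b_iter n"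
  using a b by (simp add: b_iter_def power_le_one)

lemma pgf_eq: "0 \<le> s \<Longrightarrow> s \<le> 1 \<Longrightarrow> pgf p s = pf_pgf \<theta> a b s"
  using pf by (auto simp: power_fractional_def)

section \<open>Means and generating functions of the generations\<close>

lemma offspring_mean_eq: "offspring_mean p = a powr (- 1 / \<theta>)"
proof -
  have "((\<lambda>t. (1 - pgf p (1 - t)) / t) \<longlongrightarrow> a powr (- 1 / \<theta>)) (at_right 0)"
  proof (rule Lim_transform_eventually[OF pf_tail_div_tendsto[of \<theta> a b]])
    show "\<forall>\<^sub>F t in at_right 0. pf_tail \<theta> a b t / t = (1 - pgf p (1 - t)) / t"
      using eventually_at_right_real[OF zero_less_one]
      by eventually_elim (simp add: pgf_eq pf_pgf_eq)
  qed (use \<theta> a b in auto)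
  \<comment> \<open>\<open>p\<close> itself serves as the probability space, with the identity as
    random variable.\<close>
  from measure_pmf.expectation_eq_of_gf[of "\<lambda>k. k" p, OF _ this[unfolded pgf_def]]
  show ?thesis by (simp add: offspring_mean_def)
qed

lemma offspring_mean_inverse: "offspring_mean p = 1 / \<rho>"
  using a_pow_powr[of 1] by (simp add: offspring_mean_eq)

lemma normalized_eq: "normalized p Z n \<omega> = real (Z n \<omega>) * \<rho> ^ n"
  by (simp add: normalized_def offspring_mean_inverse power_one_over)

lemma pgf_deriv: "(pgf p has_real_derivative offspring_mean p) (at 1 within {0..1})"
proof -
  have "filterlim (\<lambda>s::real. 1 - s) (at_right 0) (at 1 within {0..1})"
  proof -
    have "((\<lambda>s::real. 1 - s) \<longlongrightarrow> 1 - 1) (at 1 within {0..1})"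
      by (intro tendsto_intros)
    then show ?thesis by (auto simp: filterlim_at eventually_at_filter)
  qed
  with pf_tail_div_tendsto[of \<theta> a b]
  have "((\<lambda>s. pf_tail \<theta> a b (1 - s) / (1 - s)) \<longlongrightarrow> offspring_mean p) (at 1 within {0..1})"
    using \<theta> a b by (auto simp: offspring_mean_eq intro: filterlim_compose)
  moreover have "\<forall>\<^sub>F s in at 1 within {0..1}. pf_tail \<theta> a b (1 - s) / (1 - s) = (pgf p s - pgf p 1) / (s - 1)"
    unfolding eventually_at_filter
    by (intro always_eventually) (auto simp: pgf_eq pf_pgf_eq divide_simps, simp add: algebra_simps)
  ultimately have "((\<lambda>s. (pgf p s - pgf p 1) / (s - 1)) \<longlongrightarrow> offspring_mean p) (at 1 within {0..1})"
    by (rule Lim_transform_eventually)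
  then show ?thesis by (simp add: has_field_derivative_iff)
qed

text \<open>Peeling off the last generation replaces \<open>s\<close> by \<open>pgf p s\<close>,
  hence the induction over all \<open>s\<close>; the parameters then compose by
  \<open>pf_tail_comp\<close>.\<close>

lemma gf_Z:
  assumes "0 \<le> s" "s \<le> 1"
  shows "expectation (\<lambda>\<omega>. s ^ Z n \<omega>) = 1 - pf_tail \<theta> (a ^ n) (b_iter n) (1 - s)"
  using assms
proof (induction n arbitrary: s)
  case 0
  have "expectation (\<lambda>\<omega>. s ^ Z 0 \<omega>) = expectation (\<lambda>\<omega>. s)"
    by (intro Bochner_Integration.integral_cong) (simp_all add: Z_0)
  \<comment> \<open>The parameters 1 and 0 give the identity, matching the single ancestor.\<close>
  moreover have "pf_tail \<theta> 1 0 (1 - s) = 1 - s"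
    using \<theta> 0 by (simp add: pf_tail_def powr_powr flip: powr_minus_divide)
  ultimately show ?case by (simp add: b_iter_def prob_space)
next
  case (Suc n)
  have "expectation (\<lambda>\<omega>. s ^ Z (Suc n) \<omega>) = expectation (\<lambda>\<omega>. pgf p s ^ Z n \<omega>)"
    using branching[of 1 s n] Suc.prems by simp
  also have "\<dots> = 1 - pf_tail \<theta> (a ^ n) (b_iter n) (pf_tail \<theta> a b (1 - s))"
    using Suc.IH[of "pgf p s"] Suc.prems pgf_bounds[of s] by (simp add: pgf_eq pf_pgf_eq)
  also have "\<dots> = 1 - pf_tail \<theta> (a ^ n * a) (a ^ n * b + b_iter n) (1 - s)"
    using \<theta> a b Suc.prems by (subst pf_tail_comp) auto
  also have "a ^ n * b + b_iter n = b_iter (Suc n)"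
    using a by (simp add: b_iter_def field_simps)
  finally show ?case by (simp add: mult.commute)
qed

lemma mean_Z:
  "integrable M (\<lambda>\<omega>. real (Z n \<omega>))" "expectation (\<lambda>\<omega>. real (Z n \<omega>)) = (1 / \<rho>) ^ n"
proof -
  have "((\<lambda>t. (1 - expectation (\<lambda>\<omega>. (1 - t) ^ Z n \<omega>)) / t) \<longlongrightarrow> (a ^ n) powr (- 1 / \<theta>)) (at_right 0)"
  proof (rule Lim_transform_eventually[OF pf_tail_div_tendsto[of \<theta> "a ^ n" "b_iter n"]])
    show "\<forall>\<^sub>F t in at_right 0. pf_tail \<theta> (a ^ n) (b_iter n) t / t =
        (1 - expectation (\<lambda>\<omega>. (1 - t) ^ Z n \<omega>)) / t"
      using eventually_at_right_real[OF zero_less_one]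
      by eventually_elim (simp add: gf_Z)
  qed (use \<theta> a b_iter_nonneg in auto)
  from expectation_eq_of_gf[OF measurable_Z this]
  show "integrable M (\<lambda>\<omega>. real (Z n \<omega>))" "expectation (\<lambda>\<omega>. real (Z n \<omega>)) = (1 / \<rho>) ^ n"
    using a_pow_powr[of n] by simp_all
qed

lemma mean_normalized:
  "integrable M (normalized p Z n)" "expectation (normalized p Z n) = 1"
proof -
  have eq: "normalized p Z n = (\<lambda>\<omega>. real (Z n \<omega>) * \<rho> ^ n)"
    by (simp add: fun_eq_iff normalized_eq)
  show "integrable M (normalized p Z n)" unfolding eq using mean_Z[of n] by simp
  have "expectation (normalized p Z n) = (1 / \<rho>) ^ n * \<rho> ^ n" unfolding eq using mean_Z[of n] by simp
  also have "\<dots> = 1" using \<rho> by (simp flip: power_mult_distrib)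
  finally show "expectation (normalized p Z n) = 1" .
qed

section \<open>Extinction and the limit of the Laplace transforms\<close>

lemma b_iter_tendsto: "b_iter \<longlonglongrightarrow> b / (1 - a)"
proof -
  have "(\<lambda>n. b * (1 - a ^ n) / (1 - a)) \<longlonglongrightarrow> b * (1 - 0) / (1 - a)"
    using a by (intro tendsto_intros LIMSEQ_realpow_zero) auto
  then show ?thesis by (simp add: b_iter_def[abs_def])
qed

lemma extinction:
  "(\<lambda>n. measure M {\<omega> \<in> space M. Z n \<omega> = 0}) \<longlonglongrightarrow> 1 - ((1 - a) / b) powr (1 / \<theta>)"
proof -
  have "measure M {\<omega> \<in> space M. Z n \<omega> = 0} = 1 - (a ^ n + b_iter n) powr (- 1 / \<theta>)" for n
  proof -
    have "measure M {\<omega> \<in> space M. Z n \<omega> = 0} = expectation (indicator {\<omega> \<in> space M. Z n \<omega> = 0})"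
      by (simp add: Int_absorb1 Collect_conj_eq)
    \<comment> \<open>Since \<open>0 ^ 0 = 1\<close>, the power \<open>0 ^ Z n \<omega>\<close> is
      the indicator of \<open>Z n \<omega> = 0\<close>.\<close>
    also have "\<dots> = expectation (\<lambda>\<omega>. 0 ^ Z n \<omega>)"
      by (intro Bochner_Integration.integral_cong) (auto simp: indicator_def)
    finally show ?thesis using gf_Z[of 0 n] by (simp add: pf_tail_def)
  qed
  moreover have "(\<lambda>n. 1 - (a ^ n + b_iter n) powr (- 1 / \<theta>)) \<longlonglongrightarrow> 1 - (0 + b / (1 - a)) powr (- 1 / \<theta>)"
    using a b by (intro tendsto_intros b_iter_tendsto LIMSEQ_realpow_zero) auto
  moreover have "(b / (1 - a)) powr (- 1 / \<theta>) = ((1 - a) / b) powr (1 / \<theta>)"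
    using a b by (simp add: powr_minus powr_divide)
  ultimately show ?thesis by simp
qed

text \<open>The transform at \<open>u\<close> is the generating function of \<open>Z n\<close> at
  \<open>1 - t n\<close>, where \<open>t n\<close> behaves like \<open>u * \<rho> ^ n\<close>. As
  \<open>(\<rho> ^ n) powr \<theta> = a ^ n\<close>, the quotient
  \<open>a ^ n / t n powr \<theta>\<close> tends to \<open>1 / u powr \<theta>\<close>.\<close>

lemma laplace_tendsto:
  assumes u: "0 \<le> u"
  shows "(\<lambda>n. expectation (\<lambda>\<omega>. exp (- u * normalized p Z n \<omega>))) \<longlonglongrightarrow> pf_laplace \<theta> a b u"
proof (cases "u = 0")
  case True
  then show ?thesis by (simp add: prob_space pf_laplace_def)
next
  case False
  with u have u: "0 < u" by simp
  define t where "t n = 1 - exp (- u * \<rho> ^ n)" for n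
  have t: "0 < t n" "t n \<le> 1" for n using u \<rho> by (auto simp: t_def)
  have "((\<lambda>x. 1 - exp (- u * x)) has_real_derivative u) (at 0)"
    by (auto intro!: derivative_eq_intros)
  then have "((\<lambda>x. (1 - exp (- u * x)) / x) \<longlongrightarrow> u) (at_right 0)"
    by (auto simp: has_field_derivative_iff intro: tendsto_mono[OF at_le])
  from filterlim_compose[OF this \<rho>_pow_at_right] have "(\<lambda>n. t n / \<rho> ^ n) \<longlonglongrightarrow> u"
    by (simp add: t_def)
  then have "(\<lambda>n. inverse (t n / \<rho> ^ n) powr \<theta>) \<longlonglongrightarrow> inverse u powr \<theta>"
    using u by (intro tendsto_intros) auto
  moreover have "inverse (t n / \<rho> ^ n) powr \<theta> = a ^ n / t n powr \<theta>" for n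
    using t[of n] \<rho> by (simp add: powr_divide \<rho>_pow_powr)
  moreover have "inverse u powr \<theta> = 1 / u powr \<theta>"
    using u by (simp add: powr_divide inverse_eq_divide)
  ultimately have *: "(\<lambda>n. a ^ n / t n powr \<theta>) \<longlonglongrightarrow> 1 / u powr \<theta>" by simp
  have "1 / u powr \<theta> + b / (1 - a) > 0"
    using u a b by (intro add_pos_pos) auto
  then have "(\<lambda>n. 1 - (a ^ n / t n powr \<theta> + b_iter n) powr (- 1 / \<theta>)) \<longlonglongrightarrow>
      1 - (1 / u powr \<theta> + b / (1 - a)) powr (- 1 / \<theta>)"
    by (intro tendsto_intros * b_iter_tendsto) auto
  moreover have "expectation (\<lambda>\<omega>. exp (- u * normalized p Z n \<omega>)) =
      1 - (a ^ n / t n powr \<theta> + b_iter n) powr (- 1 / \<theta>)" for n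
  proof -
    have "expectation (\<lambda>\<omega>. exp (- u * normalized p Z n \<omega>)) = expectation (\<lambda>\<omega>. (1 - t n) ^ Z n \<omega>)"
      by (simp add: t_def normalized_eq mult_ac flip: exp_of_nat_mult)
    also have "\<dots> = 1 - pf_tail \<theta> (a ^ n) (b_iter n) (t n)"
      using t[of n] gf_Z[of "1 - t n" n] by simp
    finally show ?thesis using t[of n] by (simp add: pf_tail_def)
  qed
  ultimately show ?thesis using u by (simp add: pf_laplace_def)
qed

section \<open>The bounded martingale and its convergence\<close>

definition s :: "nat \<Rightarrow> real" where "s n = pf_laplace \<theta> a b (\<rho> ^ n)"

lemma s_bounds: "0 < s n" "s n < 1"
  using pf_laplace_bounds[of \<theta> a b "\<rho> ^ n"] pf_laplace_less_1[of a b "\<rho> ^ n" \<theta>] \<theta> a b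
  by (auto simp: s_def less_imp_le)

text \<open>The functional equation at \<open>\<rho> ^ n\<close>; together with
  \<open>branching\<close> it makes \<open>X\<close> a martingale.\<close>

lemma pgf_s: "pgf p (s (Suc n)) = s n"
  using pf_pgf_pf_laplace[of \<theta> a b "\<rho> ^ n"] s_bounds[of "Suc n"] \<theta> a b
  by (subst pgf_eq) (auto simp: s_def \<rho>_def)

lemma one_minus_s_le: "1 - s n \<le> \<rho> ^ n"
  using pf_tail_le[of \<theta> 1 "b / (1 - a)" "\<rho> ^ n"] \<theta> a b
  by (simp add: s_def pf_laplace_eq less_imp_le)

definition X :: "nat \<Rightarrow> 'a \<Rightarrow> real" where "X n \<omega> = s n ^ Z n \<omega>"

lemma X_bounds: "0 < X n \<omega>" "X n \<omega> \<le> 1"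
  using s_bounds[of n] by (auto simp: X_def power_le_one)

lemma measurable_X [measurable]: "X n \<in> borel_measurable M"
  unfolding X_def by measurable

lemma integrable_X_mult: "integrable M (\<lambda>\<omega>. X m \<omega> * X n \<omega>)"
  using X_bounds by (intro integrable_const_bound[where B = 1]) (auto simp: abs_mult less_imp_le intro!: mult_le_one)

text \<open>The martingale property turns the cross term into the second moment of
  \<open>X n\<close>. What remains is the expectation of a difference of \<open>Z n\<close>-th
  powers, which \<open>diff_power_le\<close> and \<open>pf_pgf_square_diff_le\<close> bound by a
  multiple of the mean of \<open>Z n\<close>.\<close>

lemma X_increment_square:
  obtains C where "0 \<le> C" "\<And>n. expectation (\<lambda>\<omega>. (X (Suc n) \<omega> - X n \<omega>)\<^sup>2) \<le> C * a ^ n"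
proof -
  obtain C where C: "0 \<le> C"
    "\<And>s. \<lbrakk>0 \<le> s; s \<le> 1\<rbrakk> \<Longrightarrow> pf_pgf \<theta> a b (s\<^sup>2) - (pf_pgf \<theta> a b s)\<^sup>2 \<le> C * (1 - s) powr (1 + \<theta>)"
    using pf_pgf_square_diff_le[of \<theta> a b] \<theta> a b by (metis less_imp_le)
  show ?thesis
  proof (rule that[OF C(1)])
    fix n
    note s0 = s_bounds[of n] and s1 = s_bounds[of "Suc n"]
    define x where "x = pgf p ((s (Suc n))\<^sup>2)"
    have s2: "0 \<le> (s (Suc n))\<^sup>2" "(s (Suc n))\<^sup>2 \<le> 1" using s1 by (auto simp: power_le_one)
    have x: "0 \<le> x" "x \<le> 1" using pgf_bounds[OF s2] by (auto simp: x_def)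
    have sn2: "0 \<le> (s n)\<^sup>2" "(s n)\<^sup>2 \<le> 1" using s0 by (auto simp: power_le_one)
    have XX: "X m \<omega> * X m \<omega> = ((s m)\<^sup>2) ^ Z m \<omega>" for m \<omega>
      by (simp add: X_def power2_eq_square power_mult_distrib)
    have 1: "expectation (\<lambda>\<omega>. X (Suc n) \<omega> * X (Suc n) \<omega>) = expectation (\<lambda>\<omega>. x ^ Z n \<omega>)"
      unfolding XX using branching[of 1 "(s (Suc n))\<^sup>2" n] s2 by (simp add: x_def)
    have 2: "expectation (\<lambda>\<omega>. X n \<omega> * X (Suc n) \<omega>) = expectation (\<lambda>\<omega>. ((s n)\<^sup>2) ^ Z n \<omega>)"
      using branching[of "s n" "s (Suc n)" n] s0 s1 by (simp add: X_def pgf_s power2_eq_square)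
    have "expectation (\<lambda>\<omega>. (X (Suc n) \<omega> - X n \<omega>)\<^sup>2) =
        expectation (\<lambda>\<omega>. X (Suc n) \<omega> * X (Suc n) \<omega> - 2 * (X n \<omega> * X (Suc n) \<omega>) + X n \<omega> * X n \<omega>)"
      by (intro Bochner_Integration.integral_cong) (auto simp: power2_eq_square algebra_simps)
    also have "\<dots> = expectation (\<lambda>\<omega>. X (Suc n) \<omega> * X (Suc n) \<omega>)
        - 2 * expectation (\<lambda>\<omega>. X n \<omega> * X (Suc n) \<omega>) + expectation (\<lambda>\<omega>. X n \<omega> * X n \<omega>)"
      using integrable_X_mult by simp
    also have "\<dots> = expectation (\<lambda>\<omega>. x ^ Z n \<omega>) - expectation (\<lambda>\<omega>. ((s n)\<^sup>2) ^ Z n \<omega>)"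
      unfolding 1 2 by (simp add: XX)
    also have "\<dots> = expectation (\<lambda>\<omega>. x ^ Z n \<omega> - ((s n)\<^sup>2) ^ Z n \<omega>)"
      using integrable_pow[of x 1 "Z n" "Z n"] integrable_pow[of "(s n)\<^sup>2" 1 "Z n" "Z n"] x sn2
      by simp
    also have "\<dots> \<le> expectation (\<lambda>\<omega>. real (Z n \<omega>) * (C * (1 - s (Suc n)) powr (1 + \<theta>)))"
    proof (rule integral_mono)
      fix \<omega>
      have "x - (s n)\<^sup>2 \<le> C * (1 - s (Suc n)) powr (1 + \<theta>)"
        using C(2)[of "s (Suc n)"] s1 s2 pgf_s[of n] by (simp add: x_def pgf_eq)
      then show "x ^ Z n \<omega> - ((s n)\<^sup>2) ^ Z n \<omega> \<le> real (Z n \<omega>) * (C * (1 - s (Suc n)) powr (1 + \<theta>))"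
        using C(1) x sn2 by (intro diff_power_le) auto
    qed (use integrable_pow[of x 1 "Z n" "Z n"] integrable_pow[of "(s n)\<^sup>2" 1 "Z n" "Z n"] x sn2 mean_Z in auto)
    also have "\<dots> = (1 / \<rho>) ^ n * (C * (1 - s (Suc n)) powr (1 + \<theta>))"
      by (simp add: mean_Z)
    \<comment> \<open>The growth \<open>(1 / \<rho>) ^ n\<close> of the mean cancels one factor of
      \<open>(\<rho> ^ n) powr (1 + \<theta>) = \<rho> ^ n * a ^ n\<close>, and the decay
      \<open>a ^ n\<close> survives.\<close>
    also have "\<dots> \<le> (1 / \<rho>) ^ n * (C * (\<rho> ^ n * a ^ n))"
    proof (intro mult_left_mono)
      have "1 - s (Suc n) \<le> \<rho> ^ n"
        using one_minus_s_le[of "Suc n"] \<rho> power_decreasing[of n "Suc n" \<rho>] by linarith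
      then have "(1 - s (Suc n)) powr (1 + \<theta>) \<le> (\<rho> ^ n) powr (1 + \<theta>)"
        using \<theta> s1 by (intro powr_mono2) auto
      also have "\<dots> = \<rho> ^ n * a ^ n"
        using \<rho> by (simp add: powr_add \<rho>_pow_powr)
      finally show "(1 - s (Suc n)) powr (1 + \<theta>) \<le> \<rho> ^ n * a ^ n" .
    qed (use C \<rho> in auto)
    also have "\<dots> = C * a ^ n"
      using \<rho> by (simp add: power_one_over)
    finally show "expectation (\<lambda>\<omega>. (X (Suc n) \<omega> - X n \<omega>)\<^sup>2) \<le> C * a ^ n" .
  qed
qed

text \<open>In \<open>L^1\<close> the increments decay like \<open>sqrt a ^ n\<close>, so they are
  absolutely summable almost surely and \<open>X\<close> telescopes.\<close>

lemma AE_X_convergent: "AE \<omega> in M. convergent (\<lambda>n. X n \<omega>)"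
proof -
  obtain C where C: "0 \<le> C" "\<And>n. expectation (\<lambda>\<omega>. (X (Suc n) \<omega> - X n \<omega>)\<^sup>2) \<le> C * a ^ n"
    using X_increment_square by blast
  have int: "integrable M (\<lambda>\<omega>. X (Suc n) \<omega> - X n \<omega>)" for n
    using X_bounds by (intro Bochner_Integration.integrable_diff integrable_const_bound[where B = 1])
      (auto simp: less_imp_le)
  have int2: "integrable M (\<lambda>\<omega>. (X (Suc n) \<omega> - X n \<omega>)\<^sup>2)" for n
    using integrable_X_mult by (simp add: power2_eq_square algebra_simps)
  have le: "expectation (\<lambda>\<omega>. \<bar>X (Suc n) \<omega> - X n \<omega>\<bar>) \<le> sqrt C * sqrt a ^ n" for n
  proof -
    have "expectation (\<lambda>\<omega>. \<bar>X (Suc n) \<omega> - X n \<omega>\<bar>) \<le> sqrt (expectation (\<lambda>\<omega>. (X (Suc n) \<omega> - X n \<omega>)\<^sup>2))"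
      by (rule expectation_abs_le_sqrt[OF int int2])
    also have "\<dots> \<le> sqrt (C * a ^ n)" using C(2) by (rule real_sqrt_le_mono)
    finally show ?thesis by (simp add: real_sqrt_mult real_sqrt_power)
  qed
  have "summable (\<lambda>n. sqrt C * sqrt a ^ n)"
    using a by (intro summable_mult summable_geometric) auto
  then have "summable (\<lambda>n. expectation (\<lambda>\<omega>. \<bar>X (Suc n) \<omega> - X n \<omega>\<bar>))"
    by (rule summable_comparison_test'[where N = 0]) (use le in simp)
  then have "AE \<omega> in M. summable (\<lambda>n. \<bar>X (Suc n) \<omega> - X n \<omega>\<bar>)"
    using int by (intro AE_summable_of_summable_expectation) auto
  then show ?thesis
  proof eventually_elim
    case (elim \<omega>)
    then have "summable (\<lambda>n. X (Suc n) \<omega> - X n \<omega>)" by (rule summable_rabs_cancel)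
    then have "convergent (\<lambda>n. X 0 \<omega> + (\<Sum>i<n. X (Suc i) \<omega> - X i \<omega>))"
      by (intro convergent_add convergent_const) (simp add: summable_iff_convergent)
    then show ?case by (simp add: sum_lessThan_telescope[of "\<lambda>n. X n \<omega>"])
  qed
qed

section \<open>The limit variable\<close>

text \<open>A liminf in \<open>ennreal\<close> exists and is measurable whether or not the sequence
  converges, and Fatou's lemma applies to it directly. \<open>enn2real\<close> sends the value
  \<open>\<infinity>\<close>, taken only on a null set, to 0.\<close>

definition W :: "'a \<Rightarrow> real" where
  "W \<omega> = enn2real (liminf (\<lambda>n. ennreal (normalized p Z n \<omega>)))"

lemma measurable_normalized [measurable]: "normalized p Z n \<in> borel_measurable M"
  using mean_normalized(1) by auto

lemma normalized_nonneg: "0 \<le> normalized p Z n \<omega>"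
  using \<rho> by (simp add: normalized_eq less_imp_le)

lemma W_nonneg: "0 \<le> W \<omega>"
  by (simp add: W_def)

lemma measurable_W [measurable]: "W \<in> borel_measurable M"
  unfolding W_def by measurable

lemma nn_integral_liminf_normalized:
  "(\<integral>\<^sup>+\<omega>. liminf (\<lambda>n. ennreal (normalized p Z n \<omega>)) \<partial>M) \<le> 1"
proof -
  have "(\<integral>\<^sup>+\<omega>. liminf (\<lambda>n. ennreal (normalized p Z n \<omega>)) \<partial>M)
      \<le> liminf (\<lambda>n. \<integral>\<^sup>+\<omega>. ennreal (normalized p Z n \<omega>) \<partial>M)"
    by (rule nn_integral_liminf) measurable
  also have "\<dots> = 1"
    using mean_normalized normalized_nonneg by (simp add: nn_integral_eq_integral Liminf_const)
  finally show ?thesis .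
qed

lemma AE_liminf_finite: "AE \<omega> in M. liminf (\<lambda>n. ennreal (normalized p Z n \<omega>)) \<noteq> \<infinity>"
  using nn_integral_liminf_normalized by (intro nn_integral_PInf_AE) (auto simp: top_unique)

text \<open>Both \<open>\<rho> ^ n\<close> and \<open>- ln (s n)\<close> are asymptotic to
  \<open>1 - s n\<close>, by the slopes at 0 of the tail and of \<open>- ln (1 - x)\<close>.\<close>

lemma neg_ln_s_div_tendsto: "(\<lambda>n. \<rho> ^ n / - ln (s n)) \<longlonglongrightarrow> 1"
proof -
  have "((\<lambda>t. pf_tail \<theta> 1 (b / (1 - a)) t / t) \<longlongrightarrow> 1) (at_right 0)"
    using pf_tail_div_tendsto[of \<theta> 1 "b / (1 - a)"] \<theta> a b by simp
  from filterlim_compose[OF this \<rho>_pow_at_right] have 1: "(\<lambda>n. (1 - s n) / \<rho> ^ n) \<longlonglongrightarrow> 1"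
    by (simp add: s_def pf_laplace_eq)
  have "(\<lambda>n. 1 - s n) \<longlonglongrightarrow> 0"
    using s_bounds one_minus_s_le
    by (intro tendsto_sandwich[OF _ _ tendsto_const \<rho>_pow_tendsto]) (auto simp: less_imp_le)
  then have lim: "filterlim (\<lambda>n. 1 - s n) (at_right 0) sequentially"
    using s_bounds by (auto simp: filterlim_at less_imp_neq)
  have "((\<lambda>x. - ln (1 - x)) has_real_derivative 1) (at 0)"
    by (auto intro!: derivative_eq_intros)
  then have "(\<lambda>x. - ln (1 - x) / x) \<midarrow>0\<rightarrow> (1::real)"
    by (simp add: has_field_derivative_iff)
  then have "((\<lambda>x. - ln (1 - x) / x) \<longlongrightarrow> (1::real)) (at_right 0)"
    by (rule tendsto_mono[OF at_le, rotated]) simp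
  from filterlim_compose[OF this lim] have 2: "(\<lambda>n. - ln (s n) / (1 - s n)) \<longlonglongrightarrow> 1" by simp
  have "(\<lambda>n. inverse (- ln (s n) / (1 - s n) * ((1 - s n) / \<rho> ^ n))) \<longlonglongrightarrow> inverse (1 * 1)"
    by (intro tendsto_intros 1 2) auto
  moreover have "inverse (- ln (s n) / (1 - s n) * ((1 - s n) / \<rho> ^ n)) = \<rho> ^ n / - ln (s n)" for n
    using s_bounds[of n] by (simp add: divide_simps)
  ultimately show ?thesis by (simp only: mult_1_right inverse_1)
qed

lemma normalized_eq_ln_X: "normalized p Z n \<omega> = - ln (X n \<omega>) * (\<rho> ^ n / - ln (s n))"
  using s_bounds[of n] by (simp add: normalized_eq X_def ln_realpow)

lemma AE_normalized_tendsto: "AE \<omega> in M. (\<lambda>n. normalized p Z n \<omega>) \<longlonglongrightarrow> W \<omega>"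
  using AE_X_convergent AE_liminf_finite
proof eventually_elim
  case (elim \<omega>)
  then obtain L where L: "(\<lambda>n. X n \<omega>) \<longlonglongrightarrow> L" by (auto simp: convergent_def)
  have "0 \<le> L" using L X_bounds by (intro LIMSEQ_le_const[OF L]) (auto simp: less_imp_le)
  \<comment> \<open>A zero limit would send \<open>- ln (X n \<omega>)\<close>, hence the normalized
    process, to infinity, against the finite liminf.\<close>
  have "L \<noteq> 0"
  proof
    assume "L = 0"
    then have "filterlim (\<lambda>n. X n \<omega>) (at_right 0) sequentially"
      using L X_bounds by (auto simp: filterlim_at less_imp_neq[symmetric])
    then have "filterlim (\<lambda>n. - ln (X n \<omega>)) at_top sequentially"
      by (intro filterlim_compose[OF filterlim_uminus_at_top_at_bot] filterlim_compose[OF ln_at_0])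
    from filterlim_at_top_mult_tendsto_pos[OF neg_ln_s_div_tendsto _ this]
    have top: "filterlim (\<lambda>n. normalized p Z n \<omega>) at_top sequentially"
      by (simp add: normalized_eq_ln_X)
    have le: "ennreal K \<le> liminf (\<lambda>n. ennreal (normalized p Z n \<omega>))" for K
      using top by (intro Liminf_bounded) (auto simp: filterlim_at_top intro: eventually_mono ennreal_leI)
    show False
    proof (cases "liminf (\<lambda>n. ennreal (normalized p Z n \<omega>))" rule: ennreal_cases)
      case (real r)
      with le[of "r + 1"] show False by simp
    qed (use elim in simp)
  qed
  with \<open>0 \<le> L\<close> have lim: "(\<lambda>n. normalized p Z n \<omega>) \<longlonglongrightarrow> - ln L * 1"
    unfolding normalized_eq_ln_X by (intro tendsto_intros neg_ln_s_div_tendsto L) auto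
  \<comment> \<open>Nonnegativity ensures that \<open>enn2real\<close> undoes \<open>ennreal\<close>
    in \<open>W\<close>.\<close>
  have "0 \<le> - ln L * 1" using lim normalized_nonneg by (intro LIMSEQ_le_const[OF lim]) auto
  have "liminf (\<lambda>n. ennreal (normalized p Z n \<omega>)) = ennreal (- ln L * 1)"
    using lim by (intro lim_imp_Liminf tendsto_ennrealI) auto
  with lim \<open>0 \<le> - ln L * 1\<close> show ?case by (simp add: W_def)
qed

lemma integrable_W: "integrable M W" and expectation_W_le: "expectation W \<le> 1"
proof -
  have "(\<integral>\<^sup>+\<omega>. ennreal (W \<omega>) \<partial>M) \<le> (\<integral>\<^sup>+\<omega>. liminf (\<lambda>n. ennreal (normalized p Z n \<omega>)) \<partial>M)"
    unfolding W_def by (intro nn_integral_mono) (auto simp: ennreal_enn2real_if)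
  also note nn_integral_liminf_normalized
  finally have le: "(\<integral>\<^sup>+\<omega>. ennreal (W \<omega>) \<partial>M) \<le> 1" .
  then show int: "integrable M W"
    using W_nonneg by (intro integrableI_nonneg) (auto simp: less_top[symmetric] top_unique)
  from le show "expectation W \<le> 1"
    using W_nonneg by (simp add: nn_integral_eq_integral[OF int] ennreal_le_1)
qed

text \<open>Bounded convergence carries the limit of the transforms over to
  \<open>W\<close>.\<close>

lemma laplace_W:
  assumes "0 \<le> u"
  shows "expectation (\<lambda>\<omega>. exp (- u * W \<omega>)) = pf_laplace \<theta> a b u"
proof (rule LIMSEQ_unique[OF _ laplace_tendsto[OF assms]])
  show "(\<lambda>n. expectation (\<lambda>\<omega>. exp (- u * normalized p Z n \<omega>))) \<longlonglongrightarrow> expectation (\<lambda>\<omega>. exp (- u * W \<omega>))"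
  proof (rule integral_dominated_convergence[where w = "\<lambda>_. 1"])
    show "AE \<omega> in M. (\<lambda>n. exp (- u * normalized p Z n \<omega>)) \<longlonglongrightarrow> exp (- u * W \<omega>)"
      using AE_normalized_tendsto by eventually_elim (intro tendsto_intros)
    show "AE \<omega> in M. norm (exp (- u * normalized p Z n \<omega>)) \<le> 1" for n
      using assms normalized_nonneg by (intro AE_I2) simp
  qed auto
qed

text \<open>Fatou's lemma gave one inequality. For the other, \<open>1 - exp (- x) \<le> x\<close>
  bounds the difference quotient of the Laplace transform at 0 by the mean, and that quotient tends
  to 1.\<close>

lemma expectation_W: "expectation W = 1"
proof (rule antisym[OF expectation_W_le])
  have lim: "((\<lambda>t. pf_tail \<theta> 1 (b / (1 - a)) t / t) \<longlongrightarrow> 1) (at_right 0)"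
    using pf_tail_div_tendsto[of \<theta> 1 "b / (1 - a)"] \<theta> a b by simp
  have le: "pf_tail \<theta> 1 (b / (1 - a)) u / u \<le> expectation W" if u: "0 < u" for u
  proof -
    have int: "integrable M (\<lambda>\<omega>. exp (- u * W \<omega>))"
      using u W_nonneg by (intro integrable_const_bound[where B = 1]) auto
    have "pf_tail \<theta> 1 (b / (1 - a)) u = expectation (\<lambda>\<omega>. 1 - exp (- u * W \<omega>))"
      using laplace_W[of u] u int by (simp add: pf_laplace_eq prob_space)
    also have "\<dots> \<le> expectation (\<lambda>\<omega>. u * W \<omega>)"
    proof (rule integral_mono)
      show "1 - exp (- u * W \<omega>) \<le> u * W \<omega>" for \<omega>
        using exp_ge_add_one_self[of "- u * W \<omega>"] by simp
    qed (use int integrable_W in auto)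
    finally show ?thesis using u by (simp add: field_simps)
  qed
  show "1 \<le> expectation W"
    by (rule tendsto_upperbound[OF lim]) (auto simp: eventually_at_filter le)
qed

text \<open>Scheffe's lemma asks that no \<open>L^1\<close> norm along the sequence exceed that of
  the limit; here all of them equal 1.\<close>

lemma normalized_L1_tendsto: "(\<lambda>n. expectation (\<lambda>\<omega>. \<bar>normalized p Z n \<omega> - W \<omega>\<bar>)) \<longlonglongrightarrow> 0"
proof -
  have "(\<lambda>n. \<integral>\<^sup>+ \<omega>. norm (normalized p Z n \<omega> - W \<omega>) \<partial>M) \<longlonglongrightarrow> 0"
  proof (rule Scheffe_lemma2[OF measurable_normalized integrable_W AE_normalized_tendsto])
    show "(\<integral>\<^sup>+ \<omega>. norm (normalized p Z n \<omega>) \<partial>M) \<le> (\<integral>\<^sup>+ \<omega>. norm (W \<omega>) \<partial>M)" for n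
      using mean_normalized[of n] integrable_W expectation_W normalized_nonneg W_nonneg
      by (simp add: nn_integral_eq_integral)
  qed
  moreover have "(\<integral>\<^sup>+ \<omega>. norm (normalized p Z n \<omega> - W \<omega>) \<partial>M) =
      ennreal (expectation (\<lambda>\<omega>. \<bar>normalized p Z n \<omega> - W \<omega>\<bar>))" for n
    using mean_normalized[of n] integrable_W by (simp add: nn_integral_eq_integral)
  ultimately show ?thesis by (simp add: tendsto_ennreal_iff flip: ennreal_0)
qed

end

theorem theorem5p1:
  fixes \<theta> a b :: real
    and M :: "'a measure"
    and p :: "nat pmf"
    and Z :: "nat \<Rightarrow> 'a \<Rightarrow> nat"
  assumes "0 < \<theta>" "\<theta> \<le> 1"
    and "0 < a" "a < 1"
    and "0 < b" "a + b \<ge> 1"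
    and "power_fractional \<theta> a b p"
    and "galton_watson M p Z"
  shows
    "offspring_mean p = a powr (- 1 / \<theta>)
     \<and> (pgf p has_real_derivative offspring_mean p) (at 1 within {0..1})
     \<and> (\<lambda>n. measure M {\<omega> \<in> space M. Z n \<omega> = 0}) \<longlonglongrightarrow> 1 - ((1 - a) / b) powr (1 / \<theta>)
     \<and> (\<exists>W :: 'a \<Rightarrow> real.
          integrable M W
          \<and> (\<forall>n. integrable M (normalized p Z n))
          \<and> (AE \<omega> in M. (\<lambda>n. normalized p Z n \<omega>) \<longlonglongrightarrow> W \<omega>)
          \<and> (\<lambda>n. \<integral>\<omega>. \<bar>normalized p Z n \<omega> - W \<omega>\<bar> \<partial>M) \<longlonglongrightarrow> 0
          \<and> (\<forall>u\<ge>0. (\<integral>\<omega>. exp (- u * W \<omega>) \<partial>M) = pf_laplace \<theta> a b u))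
     \<and> (\<forall>u\<ge>0. pf_laplace \<theta> a b u = pgf p (pf_laplace \<theta> a b (a powr (1 / \<theta>) * u)))"
proof -
  from \<open>galton_watson M p Z\<close> obtain \<xi> where "galton_watson_process M p Z \<xi>"
    by (rule galton_watsonE)
  then interpret power_fractional_process M p Z \<xi> \<theta> a b
    using assms by (intro power_fractional_process.intro power_fractional_process_axioms.intro)
  \<comment> \<open>\<open>pgf_eq\<close> covers only the unit interval, so the inner transform is
    first placed there by \<open>pf_laplace_bounds\<close>.\<close>
  have "pf_laplace \<theta> a b u = pgf p (pf_laplace \<theta> a b (a powr (1 / \<theta>) * u))" if "0 \<le> u" for u
    using pf_laplace_bounds[of \<theta> a b "a powr (1 / \<theta>) * u"] pf_pgf_pf_laplace[of \<theta> a b u] assms that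
    by (simp add: pgf_eq)
  then show ?thesis
    using offspring_mean_eq pgf_deriv extinction integrable_W mean_normalized AE_normalized_tendsto
      normalized_L1_tendsto laplace_W
    by blast
qed

end
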